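(* Let $\Bbbk$ be an algebraically closed field. A finite-dimensional double algebra $V$ over $\Bbbk$ is a simple associative double algebra if and only if $\dim V=1$ and there exists a nonzero scalar $\alpha\in\Bbbk$ such that $\{\!\{u,v\}\!\}=\alpha\, u\otimes v$ for all $u,v\in V$.
   Context: A double algebra over a field $\Bbbk$ is a linear space $V$ with a linear map (double bracket) $V\otimes V\to V\otimes V$, $a\otimes b\mapsto \{\!\{a,b\}\!\}$. An ideal of $V$ is a subspace $I\subseteq V$ such that $\{\!\{v,w\}\!\}\in I\otimes V+V\otimes I$ whenever $v\in I$, $w\in V$ or $v\in V$, $w\in I$; it is proper if $I\neq V$. $V$ is simple if the double bracket is not identically zero and $V$ has no nonzero proper ideals. For $u\in V^{\otimes n}$ and $\sigma\in S_n$, $u^\sigma$ denotes the result of permuting the tensor factors of $u$ by $\sigma$ (e.g. $u^{(12)}$ interchanges the first two factors). The double bracket is extended linearly to four maps $V^{\otimes 3}\to V^{\otimes 3}$ by $\{\!\{a,b\otimes c\}\!\}_L=\{\!\{a,b\}\!\}\otimes c$, $\{\!\{a,b\otimes c\}\!\}_R=(b\otimes\{\!\{a,c\}\!\})^{(12)}$, $\{\!\{a\otimes b,c\}\!\}_L=(\{\!\{a,c\}\!\}\otimes b)^{(23)}$, $\{\!\{a\otimes b,c\}\!\}_R=a\otimes\{\!\{b,c\}\!\}$. $V$ is associative if for all $a,b,c\in V$: $\{\!\{a,\{\!\{b,c\}\!\}\}\!\}_L=\{\!\{\{\!\{a,b\}\!\},c\}\!\}_L$ and $\{\!\{a,\{\!\{b,c\}\!\}\}\!\}_R=\{\!\{\{\!\{a,b\}\!\},c\}\!\}_R$.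 *)

theory Defs
  imports "HOL-Library.Function_Algebras" "HOL-Combinatorics.Permutations"
    "HOL-Computational_Algebra.Polynomial"
begin

section \<open>Multilinear maps and linear maps on a subspace\<close>

definition multilinear ::
    "('k::field \<Rightarrow> 'v::ab_group_add \<Rightarrow> 'v) \<Rightarrow> ('k \<Rightarrow> 'w::ab_group_add \<Rightarrow> 'w) \<Rightarrow> nat \<Rightarrow> ('v list \<Rightarrow> 'w) \<Rightarrow> bool"
  where "multilinear s1 s2 n f \<longleftrightarrow>
    (\<forall>xs ys. length xs + Suc (length ys) = n \<longrightarrow> Vector_Spaces.linear s1 s2 (\<lambda>v. f (xs @ v # ys)))"

definition linear_on ::
    "'v set \<Rightarrow> ('k \<Rightarrow> 'v::ab_group_add \<Rightarrow> 'v) \<Rightarrow> ('k \<Rightarrow> 'w::ab_group_add \<Rightarrow> 'w) \<Rightarrow> ('v \<Rightarrow> 'w) \<Rightarrow> bool"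
  where "linear_on S s1 s2 f \<longleftrightarrow>
    (\<forall>x\<in>S. \<forall>y\<in>S. f (x + y) = f x + f y) \<and> (\<forall>c. \<forall>x\<in>S. f (s1 c x) = s2 c (f x))"

section \<open>Tensor powers of a vector space\<close>

text \<open>
  The tensor power $V^{\otimes n}$ is realised inside the dual of the space of $n$-linear forms
  on $V$: the pure tensor $v_1 \otimes \dots \otimes v_n$ is evaluation at $(v_1, \dots, v_n)$,
  and $V^{\otimes n}$ is the span of the pure tensors. Functionals take the value 0 at functions
  that are not $n$-linear forms. The universal property is proved below
  (\<open>tensor_power_universal\<close>, \<open>tensor_power_unique\<close>).
\<close>

type_synonym ('k, 'v) tensor = "('v list \<Rightarrow> 'k) \<Rightarrow> 'k"

definition tensor_scale :: "'k::field \<Rightarrow> ('k, 'v) tensor \<Rightarrow> ('k, 'v) tensor"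
  where "tensor_scale c t = (\<lambda>\<phi>. c * t \<phi>)"

interpretation tensor: vector_space "tensor_scale :: 'k::field \<Rightarrow> ('k, 'v) tensor \<Rightarrow> ('k, 'v) tensor"
  by unfold_locales (auto simp: tensor_scale_def fun_eq_iff algebra_simps)

text \<open>
  For an $n$-linear \<open>f\<close>, this is the linear map on $V^{\otimes n}$ with
  $v_1 \otimes \dots \otimes v_n \mapsto f(v_1, \dots, v_n)$; see \<open>tensor_lift_pure\<close>.
\<close>

definition tensor_lift :: "('v list \<Rightarrow> ('k, 'v) tensor) \<Rightarrow> ('k, 'v) tensor \<Rightarrow> ('k, 'v) tensor"
  where "tensor_lift f t = (\<lambda>\<psi>. t (\<lambda>vs. f vs \<psi>))"

definition pure_tensor ::
    "('k::field \<Rightarrow> 'v::ab_group_add \<Rightarrow> 'v) \<Rightarrow> 'v list \<Rightarrow> ('k, 'v) tensor"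
  where "pure_tensor scale vs = (\<lambda>\<phi>. if multilinear scale (*) (length vs) \<phi> then \<phi> vs else 0)"

definition tensor_power ::
    "('k::field \<Rightarrow> 'v::ab_group_add \<Rightarrow> 'v) \<Rightarrow> nat \<Rightarrow> ('k, 'v) tensor set"
  where "tensor_power scale n = tensor.span {pure_tensor scale vs | vs. length vs = n}"

definition tensor_mult :: "('k::field \<Rightarrow> 'v::ab_group_add \<Rightarrow> 'v) \<Rightarrow>
    ('k, 'v) tensor \<Rightarrow> ('k, 'v) tensor \<Rightarrow> ('k, 'v) tensor"
  where "tensor_mult scale s t =
    tensor_lift (\<lambda>vs. tensor_lift (\<lambda>ws. pure_tensor scale (vs @ ws)) t) s"

text \<open>Tensor factors are numbered from 0.\<close>

definition tensor_permute :: "('k::field \<Rightarrow> 'v::ab_group_add \<Rightarrow> 'v) \<Rightarrow>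
    (nat \<Rightarrow> nat) \<Rightarrow> ('k, 'v) tensor \<Rightarrow> ('k, 'v) tensor"
  where "tensor_permute scale \<sigma> = tensor_lift (\<lambda>vs. pure_tensor scale (permute_list \<sigma> vs))"

text \<open>The image of $A \otimes B$ in $V \otimes V$.\<close>

definition subspace_tensor ::
    "('k::field \<Rightarrow> 'v::ab_group_add \<Rightarrow> 'v) \<Rightarrow> 'v set \<Rightarrow> 'v set \<Rightarrow> ('k, 'v) tensor set"
  where "subspace_tensor scale A B =
    tensor.span {pure_tensor scale [a, b] | a b. a \<in> A \<and> b \<in> B}"

text \<open>
  Unification eta-expands tensors, and these two rules would then unfold sums of tensors pointwise.
\<close>

declare plus_fun_apply [simp del] zero_fun_apply [simp del]

lemma pure_tensor_in_power: "length vs = n \<Longrightarrow> pure_tensor scale vs \<in> tensor_power scale n"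
  by (auto simp: tensor_power_def intro!: tensor.span_base)

lemma tensor_power_induct [consumes 1, case_names pure zero add scale]:
  assumes t: "t \<in> tensor_power s n"
    and pure: "\<And>vs. length vs = n \<Longrightarrow> P (pure_tensor s vs)"
    and zero: "P 0"
    and add: "\<And>t u. t \<in> tensor_power s n \<Longrightarrow> u \<in> tensor_power s n \<Longrightarrow> P t \<Longrightarrow> P u \<Longrightarrow> P (t + u)"
    and scale: "\<And>c t. t \<in> tensor_power s n \<Longrightarrow> P t \<Longrightarrow> P (tensor_scale c t)"
  shows "P t"
proof -
  have "t \<in> tensor_power s n \<and> P t"
    using t unfolding tensor_power_def
  proof (induction t rule: tensor.span_induct_alt)
    case base
    show ?case by (intro conjI zero tensor.span_zero)
  next
    case (step c x y)
    then obtain vs where x: "x = pure_tensor s vs" "length vs = n" by auto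
    have 1: "x \<in> tensor_power s n" using x by (simp add: pure_tensor_in_power)
    then have 2: "tensor_scale c x \<in> tensor_power s n"
      by (simp add: tensor_power_def tensor.span_scale)
    have "P (tensor_scale c x + y)"
      using add[OF 2, of y] scale[OF 1] pure[OF x(2)] step x by (simp add: tensor_power_def)
    with 2 step show ?case by (auto simp: tensor_power_def intro: tensor.span_add)
  qed
  then show ?thesis by simp
qed

lemma tensor_power_subspace: "tensor.subspace (tensor_power scale n)"
  by (simp add: tensor_power_def tensor.subspace_span)

lemma multilinear_pure_tensor:
  assumes "vector_space scale"
  shows "multilinear scale tensor_scale n (pure_tensor scale)"
proof -
  interpret vector_space scale by fact
  show ?thesis unfolding multilinear_def
  proof (intro allI impI)
    fix xs ys :: "'b list" assume n: "length xs + Suc (length ys) = n"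
    have *: "\<phi> (xs @ (v + w) # ys) = \<phi> (xs @ v # ys) + \<phi> (xs @ w # ys)"
            "\<phi> (xs @ scale c v # ys) = c * \<phi> (xs @ v # ys)"
      if "multilinear scale (*) n \<phi>" for \<phi> v w c
    proof -
      interpret l: Vector_Spaces.linear scale "(*)" "\<lambda>v. \<phi> (xs @ v # ys)"
        using that n by (simp add: multilinear_def)
      show "\<phi> (xs @ (v + w) # ys) = \<phi> (xs @ v # ys) + \<phi> (xs @ w # ys)" by (rule l.add)
      show "\<phi> (xs @ scale c v # ys) = c * \<phi> (xs @ v # ys)" by (rule l.scale)
    qed
    show "Vector_Spaces.linear scale tensor_scale (\<lambda>v. pure_tensor scale (xs @ v # ys))"
      by unfold_locales (use n in \<open>auto simp: pure_tensor_def tensor_scale_def fun_eq_iff plus_fun_apply zero_fun_apply *\<close>)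
  qed
qed

lemma multilinear_compose:
  assumes f: "multilinear s1 s2 n f" and g: "Vector_Spaces.linear s2 s3 g"
  shows "multilinear s1 s3 n (\<lambda>vs. g (f vs))"
  unfolding multilinear_def
  using f Vector_Spaces.linear_compose[OF _ g] by (fastforce simp: multilinear_def o_def)

theorem tensor_power_unique:
  assumes g: "linear_on (tensor_power scale n) tensor_scale s2 g"
    and h: "linear_on (tensor_power scale n) tensor_scale s2 h"
    and s2: "vector_space s2"
    and eq: "\<And>vs. length vs = n \<Longrightarrow> g (pure_tensor scale vs) = h (pure_tensor scale vs)"
    and t: "t \<in> tensor_power scale n"
  shows "g t = h t"
  using t
proof (induction rule: tensor_power_induct)
  case zero
  interpret vector_space s2 by fact
  have 0: "0 \<in> tensor_power scale n" by (simp add: tensor_power_def tensor.span_zero)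
  have "g (tensor_scale 0 0) = s2 0 (g 0)" "h (tensor_scale 0 0) = s2 0 (h 0)"
    using g h 0 unfolding linear_on_def by blast+
  then show ?case unfolding scale_zero_left tensor.scale_zero_left by (rule trans[OF _ sym])
qed (use g h eq in \<open>auto simp: linear_on_def\<close>)

lemma separating_functional:
  assumes "vector_space s" "x \<noteq> y"
  shows "\<exists>g. Vector_Spaces.linear s (*) g \<and> g x \<noteq> g y"
proof -
  interpret vector_space s by fact
  interpret k: vector_space "(*) :: 'a \<Rightarrow> 'a \<Rightarrow> 'a"
    by unfold_locales (auto simp: algebra_simps)
  interpret vector_space_pair s "(*) :: 'a \<Rightarrow> 'a \<Rightarrow> 'a" ..
  have ind: "independent {x - y}" using assms by (simp add: dependent_single)
  obtain g where g: "Vector_Spaces.linear s (*) g" "g (x - y) = 1"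
    using linear_independent_extend[OF ind, of "\<lambda>_. 1"] by auto
  interpret g: Vector_Spaces.linear s "(*)" g by fact
  have "g x \<noteq> g y" using g(2) g.diff[of x y] by auto
  with g show ?thesis by blast
qed

theorem tensor_power_universal:
  fixes scale :: "'k::field \<Rightarrow> 'v::ab_group_add \<Rightarrow> 'v" and s2 :: "'k \<Rightarrow> 'w::ab_group_add \<Rightarrow> 'w"
  assumes s2: "vector_space s2" and f: "multilinear scale s2 n f"
  shows "\<exists>g. linear_on (tensor_power scale n) tensor_scale s2 g \<and>
    (\<forall>vs. length vs = n \<longrightarrow> g (pure_tensor scale vs) = f vs)"
proof -
  interpret vector_space s2 by fact
  define R where "R t w \<longleftrightarrow> (\<forall>g. Vector_Spaces.linear s2 (*) g \<longrightarrow> g w = t (\<lambda>vs. g (f vs)))"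
    for t :: "('k, 'v) tensor" and w
  have R_pure: "R (pure_tensor scale vs) (f vs)" if "length vs = n" for vs
    using that by (auto simp: R_def pure_tensor_def dest: multilinear_compose[OF f])
  have hom: "g (x + y) = g x + g y" "g (s2 c x) = c * g x" "g 0 = 0"
    if "Vector_Spaces.linear s2 (*) g" for g x y c
  proof -
    interpret l: Vector_Spaces.linear s2 "(*)" g by fact
    show "g (x + y) = g x + g y" "g (s2 c x) = c * g x" "g 0 = 0"
      by (rule l.add l.scale l.zero)+
  qed
  have R_0: "R 0 0" by (simp add: R_def hom plus_fun_apply zero_fun_apply)
  have R_add: "R (t + u) (x + y)" if "R t x" "R u y" for t u x y
    using that by (simp add: R_def hom plus_fun_apply zero_fun_apply)
  have R_scale: "R (tensor_scale c t) (s2 c x)" if "R t x" for c t x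
    using that by (simp add: R_def hom tensor_scale_def)
  have R_unique: "x = y" if "R t x" "R t y" for t x y
    using that separating_functional[OF s2, of x y] unfolding R_def by metis
  have R_ex: "\<exists>w. R t w" if "t \<in> tensor_power scale n" for t
    using that
  proof (induction rule: tensor_power_induct)
    case (pure vs) then show ?case using R_pure by blast
  next
    case zero show ?case using R_0 by blast
  next
    case (add t u) then show ?case using R_add by blast
  next
    case (scale c t) then show ?case using R_scale by blast
  qed
  define g where "g t = (SOME w. R t w)" for t
  have g: "R t (g t)" if "t \<in> tensor_power scale n" for t
    using R_ex[OF that] unfolding g_def by (rule someI_ex)
  note closed = tensor.subspace_add[OF tensor_power_subspace]
    tensor.subspace_scale[OF tensor_power_subspace]
  have "linear_on (tensor_power scale n) tensor_scale s2 g"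
    unfolding linear_on_def
    by (blast intro: R_unique g R_add R_scale closed)
  moreover have "g (pure_tensor scale vs) = f vs" if "length vs = n" for vs
    by (rule R_unique[OF g[OF pure_tensor_in_power[OF that]] R_pure[OF that]])
  ultimately show ?thesis by blast
qed

lemma linear_tensor_lift: "Vector_Spaces.linear tensor_scale tensor_scale (tensor_lift f)"
  by unfold_locales (auto simp: tensor_lift_def tensor_scale_def fun_eq_iff plus_fun_apply zero_fun_apply)

lemma linear_imp_linear_on: "Vector_Spaces.linear s1 s2 f \<Longrightarrow> linear_on S s1 s2 f"
  unfolding linear_on_def
  by (intro conjI ballI allI module_hom.add module_hom.scale) (rule Vector_Spaces.linear.axioms(3), assumption)+

lemma tensor_lift_pure:
  assumes "multilinear scale tensor_scale n f" "length vs = n"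
  shows "tensor_lift f (pure_tensor scale vs) = f vs"
proof -
  have "Vector_Spaces.linear tensor_scale (*) (\<lambda>t. t \<psi>)" for \<psi> :: "'b list \<Rightarrow> 'a"
    by unfold_locales (auto simp: tensor_scale_def plus_fun_apply algebra_simps)
  from multilinear_compose[OF assms(1) this] show ?thesis
    using assms(2) by (auto simp: tensor_lift_def pure_tensor_def)
qed

lemma multilinearI:
  assumes "vector_space s1" "vector_space s2"
    and "\<And>xs ys v w. length xs + Suc (length ys) = n \<Longrightarrow>
      f (xs @ (v + w) # ys) = f (xs @ v # ys) + f (xs @ w # ys)"
    and "\<And>xs ys c v. length xs + Suc (length ys) = n \<Longrightarrow>
      f (xs @ s1 c v # ys) = s2 c (f (xs @ v # ys))"
  shows "multilinear s1 s2 n f"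
proof -
  interpret s1: vector_space s1 by fact
  interpret s2: vector_space s2 by fact
  show ?thesis unfolding multilinear_def
  proof (intro allI impI)
    fix xs ys :: "'b list" assume "length xs + Suc (length ys) = n"
    then show "Vector_Spaces.linear s1 s2 (\<lambda>v. f (xs @ v # ys))"
      by unfold_locales (use assms(3,4) in auto)
  qed
qed

lemma multilinear_add:
  "multilinear s1 s2 n f \<Longrightarrow> length xs + Suc (length ys) = n \<Longrightarrow>
    f (xs @ (v + w) # ys) = f (xs @ v # ys) + f (xs @ w # ys)"
  unfolding multilinear_def by (blast dest: module_hom.add[OF Vector_Spaces.linear.axioms(3)])

lemma multilinear_scale:
  "multilinear s1 s2 n f \<Longrightarrow> length xs + Suc (length ys) = n \<Longrightarrow>
    f (xs @ s1 c v # ys) = s2 c (f (xs @ v # ys))"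
  unfolding multilinear_def by (blast dest: module_hom.scale[OF Vector_Spaces.linear.axioms(3)])

lemma multilinear_plus:
  assumes "vector_space s1" "vector_space s2" "multilinear s1 s2 n f" "multilinear s1 s2 n g"
  shows "multilinear s1 s2 n (\<lambda>vs. f vs + g vs)"
proof -
  interpret vector_space s2 by fact
  show ?thesis
    by (rule multilinearI[OF assms(1,2)])
      (simp_all add: multilinear_add[OF assms(3)] multilinear_add[OF assms(4)]
        multilinear_scale[OF assms(3)] multilinear_scale[OF assms(4)] scale_right_distrib)
qed

lemma multilinear_smult:
  assumes "vector_space s1" "vector_space s2" "multilinear s1 s2 n f"
  shows "multilinear s1 s2 n (\<lambda>vs. s2 c (f vs))"
proof -
  interpret vector_space s2 by fact
  show ?thesis
    by (rule multilinearI[OF assms(1,2)])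
      (simp_all add: multilinear_add[OF assms(3)] multilinear_scale[OF assms(3)]
        scale_right_distrib mult.commute)
qed

lemma multilinear_append_left:
  assumes s: "vector_space scale"
  shows "multilinear scale tensor_scale n (\<lambda>ws. pure_tensor scale (vs @ ws))"
proof (rule multilinearI[OF s tensor.vector_space_axioms])
  note m = multilinear_pure_tensor[OF s, of "length vs + n"]
  fix xs ys :: "'b list" and v w :: 'b and c :: 'a assume "length xs + Suc (length ys) = n"
  then show "pure_tensor scale (vs @ xs @ (v + w) # ys) =
      pure_tensor scale (vs @ xs @ v # ys) + pure_tensor scale (vs @ xs @ w # ys)"
    "pure_tensor scale (vs @ xs @ scale c v # ys) = tensor_scale c (pure_tensor scale (vs @ xs @ v # ys))"
    using multilinear_add[OF m, of "vs @ xs" ys v w] multilinear_scale[OF m, of "vs @ xs" ys c v]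
    by simp_all
qed

lemma multilinear_append_right:
  assumes s: "vector_space scale"
  shows "multilinear scale tensor_scale n (\<lambda>vs. pure_tensor scale (vs @ ws))"
proof (rule multilinearI[OF s tensor.vector_space_axioms])
  note m = multilinear_pure_tensor[OF s, of "n + length ws"]
  fix xs ys :: "'b list" and v w :: 'b and c :: 'a assume "length xs + Suc (length ys) = n"
  then show "pure_tensor scale ((xs @ (v + w) # ys) @ ws) =
      pure_tensor scale ((xs @ v # ys) @ ws) + pure_tensor scale ((xs @ w # ys) @ ws)"
    "pure_tensor scale ((xs @ scale c v # ys) @ ws) = tensor_scale c (pure_tensor scale ((xs @ v # ys) @ ws))"
    using multilinear_add[OF m, of xs "ys @ ws" v w] multilinear_scale[OF m, of xs "ys @ ws" c v]
    by simp_all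
qed

lemma tensor_mult_add_left: "tensor_mult scale (s + s') t = tensor_mult scale s t + tensor_mult scale s' t"
  by (auto simp: tensor_mult_def tensor_lift_def fun_eq_iff plus_fun_apply)

lemma tensor_mult_scale_left: "tensor_mult scale (tensor_scale c s) t = tensor_scale c (tensor_mult scale s t)"
  by (auto simp: tensor_mult_def tensor_lift_def tensor_scale_def fun_eq_iff)

lemma tensor_mult_0_left: "tensor_mult scale 0 t = 0"
  by (auto simp: tensor_mult_def tensor_lift_def fun_eq_iff plus_fun_apply zero_fun_apply)

lemma tensor_mult_pure_left:
  assumes s: "vector_space scale" and t: "t \<in> tensor_power scale n"
  shows "tensor_mult scale (pure_tensor scale vs) t = tensor_lift (\<lambda>ws. pure_tensor scale (vs @ ws)) t"
proof -
  interpret vector_space scale by fact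
  note l = module_hom.add[OF Vector_Spaces.linear.axioms(3)[OF linear_tensor_lift]]
    module_hom.scale[OF Vector_Spaces.linear.axioms(3)[OF linear_tensor_lift]]
  have "tensor_lift (\<lambda>ws. pure_tensor scale (us @ ws)) t \<in>
      tensor_power scale (length us + n)" for us
    using t
  proof (induction rule: tensor_power_induct)
    case (pure ws)
    then show ?case
      by (subst tensor_lift_pure[OF multilinear_append_left[OF s]])
        (auto intro: pure_tensor_in_power)
  next
    case zero
    have "tensor_lift (\<lambda>ws. pure_tensor scale (us @ ws)) 0 = 0"
      by (simp add: tensor_lift_def fun_eq_iff plus_fun_apply zero_fun_apply)
    then show ?case using tensor.subspace_0[OF tensor_power_subspace] by simp
  qed (simp_all add: l tensor.subspace_add[OF tensor_power_subspace]
        tensor.subspace_scale[OF tensor_power_subspace])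
  have m: "multilinear scale tensor_scale (length vs)
      (\<lambda>us. tensor_lift (\<lambda>ws. pure_tensor scale (us @ ws)) t)"
    using t
  proof (induction rule: tensor_power_induct)
    case (pure ws)
    then show ?case
      using multilinear_append_right[OF s, of "length vs" ws]
      by (simp add: tensor_lift_pure[OF multilinear_append_left[OF s] pure])
  next
    case zero
    show ?case
      by (rule multilinearI[OF s tensor.vector_space_axioms])
        (simp_all add: tensor_lift_def tensor_scale_def fun_eq_iff plus_fun_apply zero_fun_apply)
  next
    case (add t u)
    show ?case unfolding l
      by (rule multilinear_plus[OF s tensor.vector_space_axioms add(3,4)])
  next
    case (scale c t)
    show ?case unfolding l
      by (rule multilinear_smult[OF s tensor.vector_space_axioms scale(2)])
  qed
  show ?thesis unfolding tensor_mult_def by (rule tensor_lift_pure[OF m refl])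
qed

lemma tensor_mult_pure:
  assumes "vector_space scale"
  shows "tensor_mult scale (pure_tensor scale vs) (pure_tensor scale ws) = pure_tensor scale (vs @ ws)"
  by (simp add: tensor_mult_pure_left[OF assms pure_tensor_in_power[OF refl]]
      tensor_lift_pure[OF multilinear_append_left[OF assms] refl])

lemma tensor_mult_add_right:
  assumes s: "vector_space scale" and r: "r \<in> tensor_power scale m"
    and t: "t \<in> tensor_power scale n" and u: "u \<in> tensor_power scale n"
  shows "tensor_mult scale r (t + u) = tensor_mult scale r t + tensor_mult scale r u"
proof -
  note l = module_hom.add[OF Vector_Spaces.linear.axioms(3)[OF linear_tensor_lift]]
  note p = tensor_mult_pure_left[OF s]
  have tu: "t + u \<in> tensor_power scale n"
    using t u by (rule tensor.subspace_add[OF tensor_power_subspace])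
  show ?thesis
    using r by (induction rule: tensor_power_induct)
      (simp_all add: p[OF t] p[OF u] p[OF tu] l tensor_mult_add_left tensor_mult_scale_left
        tensor_mult_0_left tensor.scale_right_distrib)
qed

lemma tensor_mult_scale_right:
  assumes s: "vector_space scale" and r: "r \<in> tensor_power scale m"
    and t: "t \<in> tensor_power scale n"
  shows "tensor_mult scale r (tensor_scale c t) = tensor_scale c (tensor_mult scale r t)"
proof -
  note l = module_hom.scale[OF Vector_Spaces.linear.axioms(3)[OF linear_tensor_lift]]
  note p = tensor_mult_pure_left[OF s]
  have ct: "tensor_scale c t \<in> tensor_power scale n"
    using t by (rule tensor.subspace_scale[OF tensor_power_subspace])
  show ?thesis
    using r by (induction rule: tensor_power_induct)
      (simp_all add: p[OF t] p[OF ct] l tensor_mult_add_left tensor_mult_scale_left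
        tensor_mult_0_left tensor.scale_right_distrib mult.commute)
qed

lemma permute_list_update:
  assumes \<sigma>: "\<sigma> permutes {..<length xs + Suc (length ys)}"
  shows "permute_list \<sigma> (xs @ v # ys) =
    (permute_list \<sigma> (xs @ 0 # ys))[inv \<sigma> (length xs) := v]"
proof (rule nth_equalityI)
  fix i assume "i < length (permute_list \<sigma> (xs @ v # ys))"
  then have i: "i < length xs + Suc (length ys)" by simp
  have \<sigma>i: "\<sigma> i < length xs + Suc (length ys)" using permutes_in_image[OF \<sigma>] i by simp
  have e: "inv \<sigma> (length xs) = i \<longleftrightarrow> \<sigma> i = length xs"
    using permutes_inv_eq[OF \<sigma>] by auto
  show "permute_list \<sigma> (xs @ v # ys) ! i =
    (permute_list \<sigma> (xs @ 0 # ys))[inv \<sigma> (length xs) := v] ! i"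
  proof (cases "\<sigma> i = length xs")
    case True
    with i e show ?thesis by (simp add: permute_list_def del: upt_Suc)
  next
    case False
    with i e have "(permute_list \<sigma> (xs @ 0 # ys))[inv \<sigma> (length xs) := v] ! i = (xs @ 0 # ys) ! \<sigma> i"
      by (simp add: permute_list_def del: upt_Suc)
    also have "\<dots> = (xs @ v # ys) ! \<sigma> i"
      using False by (simp add: nth_append nth_Cons')
    finally show ?thesis using i by (simp add: permute_list_def del: upt_Suc)
  qed
qed simp

lemma multilinear_permute:
  assumes s: "vector_space scale" and \<sigma>: "\<sigma> permutes {..<n}"
  shows "multilinear scale tensor_scale n (\<lambda>vs. pure_tensor scale (permute_list \<sigma> vs))"
proof (rule multilinearI[OF s tensor.vector_space_axioms])
  note m = multilinear_pure_tensor[OF s, of n]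
  fix xs ys :: "'b list" and v w :: 'b and c :: 'a assume n: "length xs + Suc (length ys) = n"
  define zs where "zs = permute_list \<sigma> (xs @ 0 # ys)"
  define j where "j = inv \<sigma> (length xs)"
  have "j \<in> {..<n}" unfolding j_def
    using permutes_in_image[OF permutes_inv[OF \<sigma>], of "length xs"] n by simp
  then have j: "j < length zs" using n by (simp add: zs_def)
  have lz: "length zs = n" using n by (simp add: zs_def)
  have p: "permute_list \<sigma> (xs @ v # ys) = take j zs @ v # drop (Suc j) zs" for v
    using permute_list_update[of \<sigma> xs ys v] \<sigma> n j
    by (simp add: zs_def[symmetric] j_def[symmetric] upd_conv_take_nth_drop)
  have l: "length (take j zs) + Suc (length (drop (Suc j) zs)) = n" using j lz by simp
  show "pure_tensor scale (permute_list \<sigma> (xs @ (v + w) # ys)) =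
      pure_tensor scale (permute_list \<sigma> (xs @ v # ys)) + pure_tensor scale (permute_list \<sigma> (xs @ w # ys))"
    "pure_tensor scale (permute_list \<sigma> (xs @ scale c v # ys)) =
      tensor_scale c (pure_tensor scale (permute_list \<sigma> (xs @ v # ys)))"
    unfolding p using multilinear_add[OF m l] multilinear_scale[OF m l] by auto
qed

lemma tensor_permute_pure:
  assumes "vector_space scale" "\<sigma> permutes {..<length vs}"
  shows "tensor_permute scale \<sigma> (pure_tensor scale vs) = pure_tensor scale (permute_list \<sigma> vs)"
  unfolding tensor_permute_def by (rule tensor_lift_pure[OF multilinear_permute[OF assms] refl])

section \<open>Double algebras\<close>

text \<open>Only the values of \<open>D\<close> on $V \otimes V$ are relevant.\<close>

locale double_algebra = vector_space scale
  for scale :: "'k::field \<Rightarrow> 'v::ab_group_add \<Rightarrow> 'v" +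
  fixes D :: "('k, 'v) tensor \<Rightarrow> ('k, 'v) tensor"
  assumes bracket_closed: "t \<in> tensor_power scale 2 \<Longrightarrow> D t \<in> tensor_power scale 2"
    and bracket_linear: "linear_on (tensor_power scale 2) tensor_scale tensor_scale D"
begin

definition bracket :: "'v \<Rightarrow> 'v \<Rightarrow> ('k, 'v) tensor"
  where "bracket a b = D (pure_tensor scale [a, b])"

definition ideal :: "'v set \<Rightarrow> bool"
  where "ideal I \<longleftrightarrow> subspace I \<and>
    (\<forall>v w. v \<in> I \<or> w \<in> I \<longrightarrow>
      bracket v w \<in> {s + t | s t. s \<in> subspace_tensor scale I UNIV \<and> t \<in> subspace_tensor scale UNIV I})"

definition simple :: "bool"
  where "simple \<longleftrightarrow> (\<exists>t\<in>tensor_power scale 2. D t \<noteq> 0) \<and> (\<forall>I. ideal I \<longrightarrow> I = {0} \<or> I = UNIV)"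

text \<open>
  The four extensions of the double bracket, as maps $V^{\otimes 3} \to V^{\otimes 3}$:
  $\{\!\{a, u\}\!\}$ for $u \in V^{\otimes 2}$ is \<open>bracket_right_L\<close> or \<open>bracket_right_R\<close>
  applied to $a \otimes u$, and $\{\!\{u, c\}\!\}$ is \<open>bracket_left_L\<close> or
  \<open>bracket_left_R\<close> applied to $u \otimes c$. Only the case of three-element lists is relevant.
\<close>

definition bracket_right_L :: "('k, 'v) tensor \<Rightarrow> ('k, 'v) tensor"
  where "bracket_right_L = tensor_lift (\<lambda>vs. case vs of [a, b, c] \<Rightarrow>
    tensor_mult scale (bracket a b) (pure_tensor scale [c]) | _ \<Rightarrow> 0)"

definition bracket_right_R :: "('k, 'v) tensor \<Rightarrow> ('k, 'v) tensor"
  where "bracket_right_R = tensor_lift (\<lambda>vs. case vs of [a, b, c] \<Rightarrow>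
    tensor_permute scale (transpose 0 1) (tensor_mult scale (pure_tensor scale [b]) (bracket a c)) | _ \<Rightarrow> 0)"

definition bracket_left_L :: "('k, 'v) tensor \<Rightarrow> ('k, 'v) tensor"
  where "bracket_left_L = tensor_lift (\<lambda>vs. case vs of [a, b, c] \<Rightarrow>
    tensor_permute scale (transpose 1 2) (tensor_mult scale (bracket a c) (pure_tensor scale [b])) | _ \<Rightarrow> 0)"

definition bracket_left_R :: "('k, 'v) tensor \<Rightarrow> ('k, 'v) tensor"
  where "bracket_left_R = tensor_lift (\<lambda>vs. case vs of [a, b, c] \<Rightarrow>
    tensor_mult scale (pure_tensor scale [a]) (bracket b c) | _ \<Rightarrow> 0)"

definition associative :: "bool"
  where "associative \<longleftrightarrow> (\<forall>a b c.
    bracket_right_L (tensor_mult scale (pure_tensor scale [a]) (bracket b c)) =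
      bracket_left_L (tensor_mult scale (bracket a b) (pure_tensor scale [c])) \<and>
    bracket_right_R (tensor_mult scale (pure_tensor scale [a]) (bracket b c)) =
      bracket_left_R (tensor_mult scale (bracket a b) (pure_tensor scale [c])))"

lemma bracket_in_power: "bracket a b \<in> tensor_power scale 2"
  by (simp add: bracket_def bracket_closed pure_tensor_in_power)

lemma bracket_bilinear:
  "bracket (a + a') b = bracket a b + bracket a' b"
  "bracket a (b + b') = bracket a b + bracket a b'"
  "bracket (scale c a) b = tensor_scale c (bracket a b)"
  "bracket a (scale c b) = tensor_scale c (bracket a b)"
proof -
  note m = multilinear_pure_tensor[OF vector_space_axioms, of 2]
  have D: "t \<in> tensor_power scale 2 \<Longrightarrow> u \<in> tensor_power scale 2 \<Longrightarrow> D (t + u) = D t + D u"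
    "t \<in> tensor_power scale 2 \<Longrightarrow> D (tensor_scale c t) = tensor_scale c (D t)" for t u c
    using bracket_linear by (auto simp: linear_on_def)
  note p = pure_tensor_in_power[of "[x, y]" 2 scale for x y, simplified]
  show "bracket (a + a') b = bracket a b + bracket a' b"
    "bracket a (b + b') = bracket a b + bracket a b'"
    "bracket (scale c a) b = tensor_scale c (bracket a b)"
    "bracket a (scale c b) = tensor_scale c (bracket a b)"
    using multilinear_add[OF m, of "[]" "[b]"] multilinear_add[OF m, of "[a]" "[]"]
      multilinear_scale[OF m, of "[]" "[b]"] multilinear_scale[OF m, of "[a]" "[]"]
    by (simp_all add: bracket_def D p)
qed

lemma multilinear_3I:
  assumes "\<And>a a' b c. F [a + a', b, c] = F [a, b, c] + F [a', b, c]"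
    "\<And>a b b' c. F [a, b + b', c] = F [a, b, c] + F [a, b', c]"
    "\<And>a b c c'. F [a, b, c + c'] = F [a, b, c] + F [a, b, c']"
    "\<And>k a b c. F [scale k a, b, c] = tensor_scale k (F [a, b, c])"
    "\<And>k a b c. F [a, scale k b, c] = tensor_scale k (F [a, b, c])"
    "\<And>k a b c. F [a, b, scale k c] = tensor_scale k (F [a, b, c])"
  shows "multilinear scale tensor_scale 3 F"
proof (rule multilinearI[OF vector_space_axioms tensor.vector_space_axioms])
  fix xs ys :: "'v list" and v w :: 'v and c :: 'k
  assume n: "length xs + Suc (length ys) = 3"
  have "(\<exists>b c. xs = [] \<and> ys = [b, c]) \<or> (\<exists>a c. xs = [a] \<and> ys = [c]) \<or> (\<exists>a b. xs = [a, b] \<and> ys = [])"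
  proof (cases xs rule: remdups_adj.cases)
    case 1
    with n show ?thesis by (auto simp: numeral_eq_Suc length_Suc_conv)
  next
    case (2 x)
    with n show ?thesis by (auto simp: numeral_eq_Suc length_Suc_conv)
  next
    case (3 x y zs)
    with n show ?thesis by auto
  qed
  then show "F (xs @ (v + w) # ys) = F (xs @ v # ys) + F (xs @ w # ys)"
    "F (xs @ scale c v # ys) = tensor_scale c (F (xs @ v # ys))"
    using assms by auto
qed

text \<open>The values of the four extensions on pure tensors.\<close>

context
begin

private lemma pure_add: "pure_tensor scale [a + b] = pure_tensor scale [a] + pure_tensor scale [b]"
  using multilinear_add[OF multilinear_pure_tensor[OF vector_space_axioms], of "[]" "[]" 1] by simp

private lemma pure_scale: "pure_tensor scale [scale c a] = tensor_scale c (pure_tensor scale [a])"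
  using multilinear_scale[OF multilinear_pure_tensor[OF vector_space_axioms], of "[]" "[]" 1] by simp

private lemma perm:
  "tensor_permute scale \<sigma> (t + u) = tensor_permute scale \<sigma> t + tensor_permute scale \<sigma> u"
  "tensor_permute scale \<sigma> (tensor_scale c t) = tensor_scale c (tensor_permute scale \<sigma> t)"
  by (auto simp: tensor_permute_def tensor_lift_def tensor_scale_def fun_eq_iff plus_fun_apply zero_fun_apply)

private lemmas bilin = tensor_mult_add_left tensor_mult_scale_left pure_add pure_scale
  bracket_bilinear perm
  tensor_mult_add_right[OF vector_space_axioms pure_tensor_in_power[OF refl] bracket_in_power bracket_in_power]
  tensor_mult_add_right[OF vector_space_axioms bracket_in_power
    pure_tensor_in_power[where n = 1] pure_tensor_in_power[where n = 1]]
  tensor_mult_scale_right[OF vector_space_axioms pure_tensor_in_power[OF refl] bracket_in_power]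
  tensor_mult_scale_right[OF vector_space_axioms bracket_in_power pure_tensor_in_power[OF refl]]

lemma bracket_right_L_pure:
  "bracket_right_L (pure_tensor scale [a, b, c]) = tensor_mult scale (bracket a b) (pure_tensor scale [c])"
  unfolding bracket_right_L_def
  by (subst tensor_lift_pure[where n = 3]) (auto intro!: multilinear_3I simp: bilin)

lemma bracket_right_R_pure:
  "bracket_right_R (pure_tensor scale [a, b, c]) =
    tensor_permute scale (transpose 0 1) (tensor_mult scale (pure_tensor scale [b]) (bracket a c))"
  unfolding bracket_right_R_def
  by (subst tensor_lift_pure[where n = 3]) (auto intro!: multilinear_3I simp: bilin)

lemma bracket_left_L_pure:
  "bracket_left_L (pure_tensor scale [a, b, c]) =
    tensor_permute scale (transpose 1 2) (tensor_mult scale (bracket a c) (pure_tensor scale [b]))"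
  unfolding bracket_left_L_def
  by (subst tensor_lift_pure[where n = 3]) (auto intro!: multilinear_3I simp: bilin)

lemma bracket_left_R_pure:
  "bracket_left_R (pure_tensor scale [a, b, c]) = tensor_mult scale (pure_tensor scale [a]) (bracket b c)"
  unfolding bracket_left_R_def
  by (subst tensor_lift_pure[where n = 3]) (auto intro!: multilinear_3I simp: bilin)

end

end

end

theory Submission
  imports Defs
begin

text \<open>
  Contracting a factor of the double bracket with a functional gives operators
  $G_{a,\phi}\, w = (\phi \otimes 1)\{\!\{a, w\}\!\}$ on $V$. If $V$ is simple and associative, they act
  irreducibly, and $a \mapsto G_{a,\phi}\, w$ commutes with all of them. Over an algebraically closed
  field this map is therefore a scalar, which means $\{\!\{a, w\}\!\} = M w \otimes a$ for a linear
  operator $M$. The line through an eigenvector of $M$ is then an ideal, so it is all of $V$.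
\<close>

lemma length_2_imp_pair: "length xs = 2 \<Longrightarrow> \<exists>x y. xs = [x, y]"
  by (auto simp: numeral_eq_Suc length_Suc_conv)

section \<open>Annihilating polynomials and eigenvectors\<close>

text \<open>The vector $p(T) v$, by Horner's scheme.\<close>

definition poly_act :: "('k::field \<Rightarrow> 'v::ab_group_add \<Rightarrow> 'v) \<Rightarrow> ('v \<Rightarrow> 'v) \<Rightarrow> 'k poly \<Rightarrow> 'v \<Rightarrow> 'v"
  where "poly_act scale T p v = fold_coeffs (\<lambda>a u. scale a v + T u) p 0"

context vector_space
begin

lemma poly_act_simps:
  assumes T: "Vector_Spaces.linear scale scale T"
  shows "poly_act scale T 0 v = 0"
    "poly_act scale T (pCons a p) v = scale a v + T (poly_act scale T p v)"
    "poly_act scale T (p + q) v = poly_act scale T p v + poly_act scale T q v"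
    "poly_act scale T (smult c p) v = scale c (poly_act scale T p v)"
    "poly_act scale T (monom c i) v = scale c ((T ^^ i) v)"
proof -
  interpret T: Vector_Spaces.linear scale scale T by fact
  show 0: "poly_act scale T 0 v = 0" by (simp add: poly_act_def)
  \<comment> \<open>\<open>pCons 0 0\<close> is the zero polynomial, on which the fold does nothing;
    in that case the rule rests on \<open>T 0 = 0\<close>.\<close>
  have P: "poly_act scale T (pCons a p) v = scale a v + T (poly_act scale T p v)" for a p
    by (cases "a = 0 \<and> p = 0") (auto simp: poly_act_def T.zero)
  then show "poly_act scale T (pCons a p) v = scale a v + T (poly_act scale T p v)" .
  show "poly_act scale T (p + q) v = poly_act scale T p v + poly_act scale T q v"
    by (induction p q rule: poly_induct2) (simp_all add: 0 P T.add scale_left_distrib)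
  show S: "poly_act scale T (smult c p) v = scale c (poly_act scale T p v)" for c p
    by (induction p) (simp_all add: 0 P T.scale scale_right_distrib)
  show "poly_act scale T (monom c i) v = scale c ((T ^^ i) v)"
    by (induction i) (simp_all add: 0 P T.scale T.zero monom_0 monom_Suc)
qed

lemma poly_act_sum:
  assumes "Vector_Spaces.linear scale scale T"
  shows "poly_act scale T (\<Sum>i\<in>I. f i) v = (\<Sum>i\<in>I. poly_act scale T (f i) v)"
  by (induction I rule: infinite_finite_induct) (simp_all add: poly_act_simps[OF assms])

end

context finite_dimensional_vector_space
begin

text \<open>In finite dimension the iterates of \<open>T\<close> on \<open>v\<close> either repeat
  or are linearly dependent, and the coefficients of such a relation are those of an annihilating
  polynomial.\<close>

lemma poly_act_annihilates:
  assumes T: "Vector_Spaces.linear scale scale T"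
  shows "\<exists>p. p \<noteq> 0 \<and> poly_act scale T p v = 0"
proof (cases "inj (\<lambda>i. (T ^^ i) v)")
  case False
  then obtain i j where ij: "i \<noteq> j" "(T ^^ i) v = (T ^^ j) v" by (auto simp: inj_def)
  let ?p = "monom (1 :: 'a) i + smult (- 1) (monom 1 j)"
  have "coeff ?p i = 1" using ij by simp
  then have "?p \<noteq> 0" by (metis coeff_0 zero_neq_one)
  moreover have "poly_act scale T ?p v = 0"
    using ij by (simp only: poly_act_simps[OF T]) simp
  ultimately show ?thesis by blast
next
  case True
  then have "infinite (range (\<lambda>i. (T ^^ i) v))" by (rule range_inj_infinite)
  then have "dependent (range (\<lambda>i. (T ^^ i) v))" using finiteI_independent by blast
  then obtain t u w where t: "finite t" "t \<subseteq> range (\<lambda>i. (T ^^ i) v)"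
    and w: "w \<in> t" "u w \<noteq> 0" and sum: "(\<Sum>x\<in>t. scale (u x) x) = 0"
    unfolding dependent_explicit by blast
  \<comment> \<open>The dependence has coefficients indexed by vectors; injectivity of the iterates
    lets exponents index them instead.\<close>
  obtain J where J: "t = (\<lambda>i. (T ^^ i) v) ` J" using t(2) by (meson subset_imageE)
  have inj: "inj_on (\<lambda>i. (T ^^ i) v) J" using True inj_on_subset by blast
  have fin: "finite J" using t(1) inj finite_imageD unfolding J by blast
  let ?p = "\<Sum>i\<in>J. monom (u ((T ^^ i) v)) i"
  have "poly_act scale T ?p v = (\<Sum>i\<in>J. scale (u ((T ^^ i) v)) ((T ^^ i) v))"
    by (simp add: poly_act_sum[OF T] poly_act_simps[OF T])
  also have "\<dots> = 0" using sum unfolding J by (simp add: sum.reindex[OF inj])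
  finally have "poly_act scale T ?p v = 0" .
  moreover obtain i where i: "i \<in> J" "w = (T ^^ i) v" using w J by blast
  have "coeff ?p i = u w" using i fin by (simp add: coeff_sum)
  then have "?p \<noteq> 0" using w by auto
  ultimately show ?thesis by blast
qed

end

text \<open>Descent on the degree of a polynomial that annihilates \<open>v\<close>: split off a
  root of it until the remaining factor no longer kills \<open>v\<close>.\<close>

lemma exists_eigenvector:
  fixes scale :: "'k::alg_closed_field \<Rightarrow> 'v::ab_group_add \<Rightarrow> 'v"
  assumes fd: "finite_dimensional_vector_space scale B"
    and T: "Vector_Spaces.linear scale scale T" and v: "(v :: 'v) \<noteq> 0"
  shows "\<exists>c w. w \<noteq> 0 \<and> T w = scale c w"
proof -
  interpret finite_dimensional_vector_space scale B by fact
  note act = poly_act_simps[OF T]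
  have *: "\<exists>c w. w \<noteq> 0 \<and> T w = scale c w" if "p \<noteq> 0" "poly_act scale T p v = 0" for p
    using that
  proof (induction "degree p" arbitrary: p rule: less_induct)
    case less
    have "degree p > 0"
    proof (rule ccontr)
      assume "\<not> degree p > 0"
      then obtain a where "p = [:a:]" by (auto elim: degree_eq_zeroE)
      moreover have "T 0 = 0" by (rule module_hom.zero[OF Vector_Spaces.linear.axioms(3)[OF T]])
      ultimately show False using less.prems v by (simp add: act)
    qed
    then obtain c where "poly p c = 0" using alg_closed_imp_poly_has_root by blast
    then obtain q where q: "p = [:- c, 1:] * q" by (auto simp: poly_eq_0_iff_dvd)
    have "q \<noteq> 0" using q less.prems by auto
    then have deg: "degree q < degree p" unfolding q by (subst degree_mult_eq) simp_all
    \<comment> \<open>Multiplication by the variable is \<open>pCons 0\<close>, so the Horner rule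
      turns the factor with root \<open>c\<close> into the operator \<open>T\<close> minus
      \<open>c\<close>.\<close>
    have "p = smult (- c) q + pCons 0 q" by (simp add: q)
    then have "poly_act scale T p v = T (poly_act scale T q v) - scale c (poly_act scale T q v)"
      by (simp only: act) simp
    then have "T (poly_act scale T q v) = scale c (poly_act scale T q v)"
      using less.prems by simp
    \<comment> \<open>If q(T) v is nonzero it is the eigenvector; otherwise \<open>q\<close> is an
      annihilator of smaller degree.\<close>
    then show ?case using less.hyps[OF deg \<open>q \<noteq> 0\<close>] by blast
  qed
  show ?thesis using poly_act_annihilates[OF T, of v] * by blast
qed

section \<open>Contracting tensors with functionals\<close>

context finite_dimensional_vector_space
begin

lemma linear_representation: "Vector_Spaces.linear scale (*) (\<lambda>v. representation Basis v j)"
  by unfold_locales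
    (auto simp: representation_add representation_scale independent_Basis span_Basis algebra_simps)

lemma sum_representation_Basis: "(\<Sum>j\<in>Basis. scale (representation Basis v j) j) = v"
  by (rule sum_representation_eq) (auto simp: independent_Basis span_Basis finite_Basis)

text \<open>The linear map $V^{\otimes n} \to V$ induced by an $n$-linear \<open>f\<close>; junk on tensors of other degrees.\<close>

definition contract :: "('b list \<Rightarrow> 'b) \<Rightarrow> ('a, 'b) tensor \<Rightarrow> 'b"
  where "contract f t = (\<Sum>j\<in>Basis. scale (t (\<lambda>vs. representation Basis (f vs) j)) j)"

lemma contract_linear:
  "contract f (t + u) = contract f t + contract f u"
  "contract f (tensor_scale c t) = scale c (contract f t)"
  "contract f 0 = 0"
  by (simp_all add: contract_def plus_fun_apply zero_fun_apply tensor_scale_def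
      scale_left_distrib sum.distrib scale_sum_right)

text \<open>A tensor can be evaluated only at scalar-valued forms. Each coordinate of
  \<open>f\<close> is such a form, and the coordinates reassemble to the vector
  \<open>f vs\<close>.\<close>

lemma contract_pure:
  assumes "multilinear scale scale n f" "length vs = n"
  shows "contract f (pure_tensor scale vs) = f vs"
  using multilinear_compose[OF assms(1) linear_representation] assms(2)
  by (simp add: contract_def pure_tensor_def sum_representation_Basis)

text \<open>The names of the four slices tell which factors are fed to functionals; the remaining
  factor survives. In particular, this one is \<phi> tensored with the identity.\<close>

definition slice_left :: "('b \<Rightarrow> 'a) \<Rightarrow> ('a, 'b) tensor \<Rightarrow> 'b"
  where "slice_left \<phi> = contract (\<lambda>vs. scale (\<phi> (vs ! 0)) (vs ! 1))"

definition slice_right :: "('b \<Rightarrow> 'a) \<Rightarrow> ('a, 'b) tensor \<Rightarrow> 'b"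
  where "slice_right \<psi> = contract (\<lambda>vs. scale (\<psi> (vs ! 1)) (vs ! 0))"

definition slice12 :: "('b \<Rightarrow> 'a) \<Rightarrow> ('b \<Rightarrow> 'a) \<Rightarrow> ('a, 'b) tensor \<Rightarrow> 'b"
  where "slice12 \<phi> \<psi> = contract (\<lambda>vs. scale (\<phi> (vs ! 0) * \<psi> (vs ! 1)) (vs ! 2))"

definition slice13 :: "('b \<Rightarrow> 'a) \<Rightarrow> ('b \<Rightarrow> 'a) \<Rightarrow> ('a, 'b) tensor \<Rightarrow> 'b"
  where "slice13 \<phi> \<psi> = contract (\<lambda>vs. scale (\<phi> (vs ! 0) * \<psi> (vs ! 2)) (vs ! 1))"

lemmas slice_linear =
  contract_linear[where f = "\<lambda>vs. scale (\<phi> (vs ! 0)) (vs ! 1)" for \<phi>, folded slice_left_def]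
  contract_linear[where f = "\<lambda>vs. scale (\<psi> (vs ! 1)) (vs ! 0)" for \<psi>, folded slice_right_def]
  contract_linear[where f = "\<lambda>vs. scale (\<phi> (vs ! 0) * \<psi> (vs ! 1)) (vs ! 2)" for \<phi> \<psi>,
    folded slice12_def]
  contract_linear[where f = "\<lambda>vs. scale (\<phi> (vs ! 0) * \<psi> (vs ! 2)) (vs ! 1)" for \<phi> \<psi>,
    folded slice13_def]

lemma linear_functional:
  assumes "Vector_Spaces.linear scale (*) \<phi>"
  shows "\<phi> (x + y) = \<phi> x + \<phi> y" "\<phi> (scale c x) = c * \<phi> x" "\<phi> 0 = 0"
proof -
  interpret \<phi>: Vector_Spaces.linear scale "(*)" \<phi> by fact
  show "\<phi> (x + y) = \<phi> x + \<phi> y" "\<phi> (scale c x) = c * \<phi> x" "\<phi> 0 = 0"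
    by (rule \<phi>.add \<phi>.scale \<phi>.zero)+
qed

lemma slice_pure:
  assumes "Vector_Spaces.linear scale (*) \<phi>"
  shows slice_left_pure: "slice_left \<phi> (pure_tensor scale [x, y]) = scale (\<phi> x) y"
    and slice_right_pure: "slice_right \<phi> (pure_tensor scale [x, y]) = scale (\<phi> y) x"
proof -
  \<comment> \<open>The argument varied in \<open>xs @ v # ys\<close> may sit at either index; the
    index rules separate these cases.\<close>
  note split = nth_append nth_Cons' Suc_le_eq linear_functional[OF assms]
    scale_left_distrib scale_right_distrib mult.commute
  have "multilinear scale scale 2 (\<lambda>vs. scale (\<phi> (vs ! 0)) (vs ! 1))"
    by (rule multilinearI[OF vector_space_axioms vector_space_axioms])
      (auto simp: split)
  from contract_pure[OF this, of "[x, y]"]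
  show "slice_left \<phi> (pure_tensor scale [x, y]) = scale (\<phi> x) y"
    by (simp add: slice_left_def)
  have "multilinear scale scale 2 (\<lambda>vs. scale (\<phi> (vs ! 1)) (vs ! 0))"
    by (rule multilinearI[OF vector_space_axioms vector_space_axioms])
      (auto simp: split)
  from contract_pure[OF this, of "[x, y]"]
  show "slice_right \<phi> (pure_tensor scale [x, y]) = scale (\<phi> y) x"
    by (simp add: slice_right_def)
qed

lemma slice3_pure:
  assumes "Vector_Spaces.linear scale (*) \<phi>" "Vector_Spaces.linear scale (*) \<psi>"
  shows "slice12 \<phi> \<psi> (pure_tensor scale [x, y, z]) = scale (\<phi> x * \<psi> y) z"
    and "slice13 \<phi> \<psi> (pure_tensor scale [x, y, z]) = scale (\<phi> x * \<psi> z) y"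
proof -
  note split = nth_append nth_Cons' Suc_le_eq linear_functional[OF assms(1)]
    linear_functional[OF assms(2)]
    scale_left_distrib scale_right_distrib algebra_simps
  have "multilinear scale scale 3 (\<lambda>vs. scale (\<phi> (vs ! 0) * \<psi> (vs ! 1)) (vs ! 2))"
    by (rule multilinearI[OF vector_space_axioms vector_space_axioms])
      (auto simp: split)
  from contract_pure[OF this, of "[x, y, z]"]
  show "slice12 \<phi> \<psi> (pure_tensor scale [x, y, z]) = scale (\<phi> x * \<psi> y) z"
    by (simp add: slice12_def)
  have "multilinear scale scale 3 (\<lambda>vs. scale (\<phi> (vs ! 0) * \<psi> (vs ! 2)) (vs ! 1))"
    by (rule multilinearI[OF vector_space_axioms vector_space_axioms])
      (auto simp: split)
  from contract_pure[OF this, of "[x, y, z]"]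
  show "slice13 \<phi> \<psi> (pure_tensor scale [x, y, z]) = scale (\<phi> x * \<psi> z) y"
    by (simp add: slice13_def)
qed

section \<open>Slices of products and of permuted tensors\<close>

lemma tensor_permute_linear:
  "tensor_permute scale \<sigma> (t + u) = tensor_permute scale \<sigma> t + tensor_permute scale \<sigma> u"
  "tensor_permute scale \<sigma> (tensor_scale c t) = tensor_scale c (tensor_permute scale \<sigma> t)"
  "tensor_permute scale \<sigma> 0 = 0"
  by (auto simp: tensor_permute_def tensor_lift_def tensor_scale_def fun_eq_iff
      plus_fun_apply zero_fun_apply)

lemma tensor_permute_pure_3:
  "tensor_permute scale (transpose 1 2) (pure_tensor scale [a, b, c]) = pure_tensor scale [a, c, b]"
  "tensor_permute scale (transpose 0 1) (pure_tensor scale [a, b, c]) = pure_tensor scale [b, a, c]"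
proof -
  have "transpose (1::nat) 2 permutes {..<3}" "transpose (0::nat) 1 permutes {..<3}"
    by (auto intro!: permutes_swap_id)
  then show
    "tensor_permute scale (transpose 1 2) (pure_tensor scale [a, b, c]) = pure_tensor scale [a, c, b]"
    "tensor_permute scale (transpose 0 1) (pure_tensor scale [a, b, c]) = pure_tensor scale [b, a, c]"
    by (simp_all add: tensor_permute_pure[OF vector_space_axioms] permute_list_def
        numeral_3_eq_3 transpose_def)
qed

lemma tensor_mult_0_right:
  assumes "r \<in> tensor_power scale m"
  shows "tensor_mult scale r 0 = 0"
proof -
  have "0 \<in> tensor_power scale 0" by (rule tensor.subspace_0[OF tensor_power_subspace])
  from tensor_mult_scale_right[OF vector_space_axioms assms this, of 0] show ?thesis
    by (simp only: tensor.scale_zero_left)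
qed

text \<open>Both sides are linear in \<open>t\<close>, so pure tensors suffice. Either one
  functional lands on \<open>y\<close> and the other slices \<open>t\<close>, or both are absorbed
  by \<open>t\<close> and \<open>y\<close> survives.\<close>

lemma slice_tensor_mult:
  assumes \<phi>: "Vector_Spaces.linear scale (*) \<phi>" and \<psi>: "Vector_Spaces.linear scale (*) \<psi>"
    and t: "t \<in> tensor_power scale 2"
  shows "slice13 \<phi> \<psi> (tensor_mult scale t (pure_tensor scale [y])) = scale (\<psi> y) (slice_left \<phi> t)"
    and "slice13 \<phi> \<psi> (tensor_permute scale (transpose 1 2) (tensor_mult scale t (pure_tensor scale [y]))) =
        scale (\<phi> (slice_right \<psi> t)) y"
    and "slice12 \<phi> \<psi> (tensor_mult scale (pure_tensor scale [y]) t) = scale (\<phi> y) (slice_left \<psi> t)"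
    and "slice12 \<phi> \<psi> (tensor_permute scale (transpose 0 1) (tensor_mult scale (pure_tensor scale [y]) t)) =
        scale (\<psi> y) (slice_left \<phi> t)"
proof -
  note p1 = pure_tensor_in_power[where n = 1 and vs = "[y]" and scale = scale, simplified]
  note simps = tensor_mult_add_left tensor_mult_scale_left tensor_mult_0_left slice_linear
    tensor_mult_add_right[OF vector_space_axioms p1] tensor_mult_scale_right[OF vector_space_axioms p1]
    tensor_mult_0_right[OF p1] tensor_permute_linear linear_functional[OF \<phi>] linear_functional[OF \<psi>]
    tensor_mult_pure[OF vector_space_axioms] scale_right_distrib scale_left_distrib
    slice_pure[OF \<phi>] slice_pure[OF \<psi>] slice3_pure[OF \<phi> \<psi>] mult.commute
  show "slice13 \<phi> \<psi> (tensor_mult scale t (pure_tensor scale [y])) = scale (\<psi> y) (slice_left \<phi> t)"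
    using t by (induction rule: tensor_power_induct) (auto simp: simps dest!: length_2_imp_pair)
  show "slice13 \<phi> \<psi> (tensor_permute scale (transpose 1 2) (tensor_mult scale t (pure_tensor scale [y]))) =
      scale (\<phi> (slice_right \<psi> t)) y"
    using t by (induction rule: tensor_power_induct)
      (auto simp: simps tensor_permute_pure_3 simp del: One_nat_def dest!: length_2_imp_pair)
  show "slice12 \<phi> \<psi> (tensor_mult scale (pure_tensor scale [y]) t) = scale (\<phi> y) (slice_left \<psi> t)"
    using t by (induction rule: tensor_power_induct) (auto simp: simps dest!: length_2_imp_pair)
  show "slice12 \<phi> \<psi> (tensor_permute scale (transpose 0 1) (tensor_mult scale (pure_tensor scale [y]) t)) =
      scale (\<psi> y) (slice_left \<phi> t)"
    using t by (induction rule: tensor_power_induct)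
      (auto simp: simps tensor_permute_pure_3 simp del: One_nat_def dest!: length_2_imp_pair)
qed

section \<open>Expansion of tensors of degree two in a basis\<close>

lemma pure_tensor_2_linear:
  "pure_tensor scale [x + x', y] = pure_tensor scale [x, y] + pure_tensor scale [x', y]"
  "pure_tensor scale [x, y + y'] = pure_tensor scale [x, y] + pure_tensor scale [x, y']"
  "pure_tensor scale [scale c x, y] = tensor_scale c (pure_tensor scale [x, y])"
  "pure_tensor scale [x, scale c y] = tensor_scale c (pure_tensor scale [x, y])"
proof -
  note m = multilinear_pure_tensor[OF vector_space_axioms, of 2]
  show "pure_tensor scale [x + x', y] = pure_tensor scale [x, y] + pure_tensor scale [x', y]"
    "pure_tensor scale [x, y + y'] = pure_tensor scale [x, y] + pure_tensor scale [x, y']"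
    "pure_tensor scale [scale c x, y] = tensor_scale c (pure_tensor scale [x, y])"
    "pure_tensor scale [x, scale c y] = tensor_scale c (pure_tensor scale [x, y])"
    using multilinear_add[OF m, of "[]" "[y]"] multilinear_add[OF m, of "[x]" "[]"]
      multilinear_scale[OF m, of "[]" "[y]"] multilinear_scale[OF m, of "[x]" "[]"]
    by simp_all
qed

lemma pure_tensor_2_zero: "pure_tensor scale [0, y] = 0" "pure_tensor scale [x, 0] = 0"
  using pure_tensor_2_linear(3)[of 0 0 y] pure_tensor_2_linear(4)[of x 0 0]
  by (simp_all only: scale_zero_left tensor.scale_zero_left)

lemma pure_tensor_2_sum:
  "pure_tensor scale [\<Sum>i\<in>I. f i, y] = (\<Sum>i\<in>I. pure_tensor scale [f i, y])"
  "pure_tensor scale [x, \<Sum>i\<in>I. f i] = (\<Sum>i\<in>I. pure_tensor scale [x, f i])"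
  by (induction I rule: infinite_finite_induct)
    (simp_all add: pure_tensor_2_zero pure_tensor_2_linear)

text \<open>Expand one factor of a pure tensor in the basis and collect the other factor.
  Consequently a tensor of degree two is determined by its coordinate slices.\<close>

lemma tensor_expand:
  assumes t: "t \<in> tensor_power scale 2"
  shows tensor_expand_left:
      "t = (\<Sum>j\<in>Basis. pure_tensor scale [j, slice_left (\<lambda>v. representation Basis v j) t])"
    and tensor_expand_right:
      "t = (\<Sum>j\<in>Basis. pure_tensor scale [slice_right (\<lambda>v. representation Basis v j) t, j])"
proof -
  have pure:
    "(\<Sum>j\<in>Basis. tensor_scale (representation Basis x j) (pure_tensor scale [j, y])) = pure_tensor scale [x, y]"
    "(\<Sum>j\<in>Basis. tensor_scale (representation Basis y j) (pure_tensor scale [x, j])) = pure_tensor scale [x, y]"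
    for x y
    using pure_tensor_2_sum(1)[of "\<lambda>j. scale (representation Basis x j) j" Basis y]
      pure_tensor_2_sum(2)[of x "\<lambda>j. scale (representation Basis y j) j" Basis]
    by (simp_all add: pure_tensor_2_linear sum_representation_Basis)
  show "t = (\<Sum>j\<in>Basis. pure_tensor scale [j, slice_left (\<lambda>v. representation Basis v j) t])"
    using t by (induction rule: tensor_power_induct)
      (auto simp: slice_linear pure_tensor_2_linear pure_tensor_2_zero sum.distrib pure
        slice_pure[OF linear_representation] tensor.scale_sum_right[symmetric] dest!: length_2_imp_pair)
  show "t = (\<Sum>j\<in>Basis. pure_tensor scale [slice_right (\<lambda>v. representation Basis v j) t, j])"
    using t by (induction rule: tensor_power_induct)
      (auto simp: slice_linear pure_tensor_2_linear pure_tensor_2_zero sum.distrib pure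
        slice_pure[OF linear_representation] tensor.scale_sum_right[symmetric] dest!: length_2_imp_pair)
qed

text \<open>The coordinate slices are the right factors of the basis expansion, so membership can be
  tested on slices. This is how ideals are recognised below.\<close>

lemma subspace_tensor_rightI:
  assumes t: "t \<in> tensor_power scale 2"
    and I: "\<And>\<phi>. Vector_Spaces.linear scale (*) \<phi> \<Longrightarrow> slice_left \<phi> t \<in> I"
  shows "t \<in> subspace_tensor scale UNIV I"
proof -
  have "(\<Sum>j\<in>Basis. pure_tensor scale [j, slice_left (\<lambda>v. representation Basis v j) t])
      \<in> subspace_tensor scale UNIV I"
    unfolding subspace_tensor_def
    by (intro tensor.span_sum tensor.span_base) (blast intro: I linear_representation)
  then show ?thesis by (simp only: tensor_expand_left[OF t, symmetric])
qed

lemma subspace_tensor_leftI: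
  assumes t: "t \<in> tensor_power scale 2"
    and I: "\<And>\<phi>. Vector_Spaces.linear scale (*) \<phi> \<Longrightarrow> slice_right \<phi> t \<in> I"
  shows "t \<in> subspace_tensor scale I UNIV"
proof -
  have "(\<Sum>j\<in>Basis. pure_tensor scale [slice_right (\<lambda>v. representation Basis v j) t, j])
      \<in> subspace_tensor scale I UNIV"
    unfolding subspace_tensor_def
    by (intro tensor.span_sum tensor.span_base) (blast intro: I linear_representation)
  then show ?thesis by (simp only: tensor_expand_right[OF t, symmetric])
qed

end

section \<open>Associativity in terms of slices\<close>

locale finite_dimensional_double_algebra =
  finite_dimensional_vector_space scale Basis + double_algebra scale D
  for scale :: "'k::field \<Rightarrow> 'v::ab_group_add \<Rightarrow> 'v" and Basis D
begin

lemma bracket_zero: "bracket 0 b = 0" "bracket a 0 = 0"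
  using bracket_bilinear(3)[of 0 0 b] bracket_bilinear(4)[of a 0 0]
  by (simp_all only: scale_zero_left tensor.scale_zero_left)

text \<open>A functional composed with a sliced bracket is again a functional to slice with; the
  first associativity relation produces such functionals.\<close>

lemma linear_slice_bracket:
  assumes "Vector_Spaces.linear scale (*) \<phi>"
  shows "Vector_Spaces.linear scale (*) (\<lambda>x. \<phi> (slice_right \<psi> (bracket x c)))"
  by unfold_locales (auto simp: bracket_bilinear slice_linear linear_functional[OF assms] algebra_simps)

text \<open>The first two identities treat the two sides of the L relation, the last two those of
  the R relation. The surviving factor is chosen so that the slices become compositions of operators
  on V. By linearity in \<open>t\<close> pure tensors suffice.\<close>

lemma slice_bracket:
  assumes \<phi>: "Vector_Spaces.linear scale (*) \<phi>" and \<psi>: "Vector_Spaces.linear scale (*) \<psi>"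
    and t: "t \<in> tensor_power scale 2"
  shows "slice13 \<phi> \<psi> (bracket_right_L (tensor_mult scale (pure_tensor scale [a]) t)) =
      slice_left \<phi> (bracket a (slice_right \<psi> t))"
    and "slice13 \<phi> \<psi> (bracket_left_L (tensor_mult scale t (pure_tensor scale [a]))) =
      slice_left (\<lambda>x. \<phi> (slice_right \<psi> (bracket x a))) t"
    and "slice12 \<phi> \<psi> (bracket_right_R (tensor_mult scale (pure_tensor scale [a]) t)) =
      slice_left \<phi> (bracket a (slice_left \<psi> t))"
    and "slice12 \<phi> \<psi> (bracket_left_R (tensor_mult scale t (pure_tensor scale [a]))) =
      slice_left \<psi> (bracket (slice_left \<phi> t) a)"
proof -
  note p1 = pure_tensor_in_power[where n = 1 and vs = "[a]" and scale = scale, simplified]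
  have lift: "tensor_lift f (t + u) = tensor_lift f t + tensor_lift f u"
    "tensor_lift f (tensor_scale c t) = tensor_scale c (tensor_lift f t)"
    "tensor_lift f 0 = 0" for f and t u :: "('k, 'v) tensor" and c
    by (auto simp: tensor_lift_def tensor_scale_def fun_eq_iff plus_fun_apply zero_fun_apply)
  note ext_linear = lift[where f = "\<lambda>vs. case vs of [a, b, c] \<Rightarrow> tensor_mult scale (bracket a b) (pure_tensor scale [c]) | _ \<Rightarrow> 0",
      folded bracket_right_L_def]
    lift[where f = "\<lambda>vs. case vs of [a, b, c] \<Rightarrow> tensor_permute scale (transpose 0 1)
      (tensor_mult scale (pure_tensor scale [b]) (bracket a c)) | _ \<Rightarrow> 0",
      folded bracket_right_R_def]
    lift[where f = "\<lambda>vs. case vs of [a, b, c] \<Rightarrow> tensor_permute scale (transpose 1 2)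
      (tensor_mult scale (bracket a c) (pure_tensor scale [b])) | _ \<Rightarrow> 0",
      folded bracket_left_L_def]
    lift[where f = "\<lambda>vs. case vs of [a, b, c] \<Rightarrow> tensor_mult scale (pure_tensor scale [a]) (bracket b c) | _ \<Rightarrow> 0",
      folded bracket_left_R_def]
  note simps = tensor_mult_add_left tensor_mult_scale_left tensor_mult_0_left slice_linear
    tensor_mult_add_right[OF vector_space_axioms p1] tensor_mult_scale_right[OF vector_space_axioms p1]
    tensor_mult_0_right[OF p1] tensor_permute_linear
    tensor_mult_pure[OF vector_space_axioms] scale_right_distrib scale_left_distrib
    slice_pure[OF \<phi>] slice_pure[OF \<psi>] slice_pure[OF linear_slice_bracket[OF \<phi>]]
    slice_tensor_mult[OF \<phi> \<psi> bracket_in_power]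
    bracket_right_L_pure bracket_right_R_pure bracket_left_L_pure bracket_left_R_pure
    bracket_bilinear bracket_zero ext_linear
  show "slice13 \<phi> \<psi> (bracket_right_L (tensor_mult scale (pure_tensor scale [a]) t)) =
      slice_left \<phi> (bracket a (slice_right \<psi> t))"
    using t by (induction rule: tensor_power_induct)
      (auto simp: simps simp del: One_nat_def dest!: length_2_imp_pair)
  show "slice13 \<phi> \<psi> (bracket_left_L (tensor_mult scale t (pure_tensor scale [a]))) =
      slice_left (\<lambda>x. \<phi> (slice_right \<psi> (bracket x a))) t"
    using t by (induction rule: tensor_power_induct)
      (auto simp: simps simp del: One_nat_def dest!: length_2_imp_pair)
  show "slice12 \<phi> \<psi> (bracket_right_R (tensor_mult scale (pure_tensor scale [a]) t)) =
      slice_left \<phi> (bracket a (slice_left \<psi> t))"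
    using t by (induction rule: tensor_power_induct)
      (auto simp: simps simp del: One_nat_def dest!: length_2_imp_pair)
  show "slice12 \<phi> \<psi> (bracket_left_R (tensor_mult scale t (pure_tensor scale [a]))) =
      slice_left \<psi> (bracket (slice_left \<phi> t) a)"
    using t by (induction rule: tensor_power_induct)
      (auto simp: simps simp del: One_nat_def dest!: length_2_imp_pair)
qed

text \<open>For a functional $\phi$ and a vector $a$ write $G_{a,\phi}\, w = (\phi \otimes 1)\{\!\{a, w\}\!\}$ and
  $F_{c,\psi}\, v = (1 \otimes \psi)\{\!\{v, c\}\!\}$. The next two lemmas say
  $G_{a,\phi} F_{c,\psi} = G_{a,\,\phi \circ F_{c,\psi}}$ and $G_{a,\phi} G_{b,\psi} = G_{G_{a,\phi} b,\,\psi}$.\<close>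

lemma associative_slice13:
  assumes associative
    and \<phi>: "Vector_Spaces.linear scale (*) \<phi>" and \<psi>: "Vector_Spaces.linear scale (*) \<psi>"
  shows "slice_left \<phi> (bracket a (slice_right \<psi> (bracket b c))) =
    slice_left (\<lambda>x. \<phi> (slice_right \<psi> (bracket x c))) (bracket a b)"
proof -
  have "bracket_right_L (tensor_mult scale (pure_tensor scale [a]) (bracket b c)) =
      bracket_left_L (tensor_mult scale (bracket a b) (pure_tensor scale [c]))"
    using assms(1) by (simp add: associative_def)
  from arg_cong[OF this, of "slice13 \<phi> \<psi>"] show ?thesis
    by (simp only: slice_bracket[OF \<phi> \<psi> bracket_in_power])
qed

lemma associative_slice12:
  assumes associative
    and \<phi>: "Vector_Spaces.linear scale (*) \<phi>" and \<psi>: "Vector_Spaces.linear scale (*) \<psi>"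
  shows "slice_left \<phi> (bracket a (slice_left \<psi> (bracket b c))) =
    slice_left \<psi> (bracket (slice_left \<phi> (bracket a b)) c)"
proof -
  have "bracket_right_R (tensor_mult scale (pure_tensor scale [a]) (bracket b c)) =
      bracket_left_R (tensor_mult scale (bracket a b) (pure_tensor scale [c]))"
    using assms(1) by (simp add: associative_def)
  from arg_cong[OF this, of "slice12 \<phi> \<psi>"] show ?thesis
    by (simp only: slice_bracket[OF \<phi> \<psi> bracket_in_power])
qed

section \<open>Ideals and irreducibility\<close>

text \<open>The ideals below have each bracket in one of the two summands alone, so the other
  summand can be taken to be 0.\<close>

lemma idealI:
  assumes "subspace I"
    and "\<And>v w. v \<in> I \<Longrightarrow>
      bracket v w \<in> subspace_tensor scale I UNIV \<or> bracket v w \<in> subspace_tensor scale UNIV I"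
    and "\<And>v w. w \<in> I \<Longrightarrow>
      bracket v w \<in> subspace_tensor scale I UNIV \<or> bracket v w \<in> subspace_tensor scale UNIV I"
  shows "ideal I"
proof -
  have 0: "0 \<in> subspace_tensor scale A C" for A C
    unfolding subspace_tensor_def by (rule tensor.span_zero)
  have mem: "t \<in> {s + t | s t. s \<in> subspace_tensor scale I UNIV \<and> t \<in> subspace_tensor scale UNIV I}"
    if "t \<in> subspace_tensor scale I UNIV \<or> t \<in> subspace_tensor scale UNIV I" for t
    using that
  proof
    assume "t \<in> subspace_tensor scale I UNIV"
    then show ?thesis using 0 by (intro CollectI exI[of _ t] exI[of _ 0]) simp
  next
    assume "t \<in> subspace_tensor scale UNIV I"
    then show ?thesis using 0 by (intro CollectI exI[of _ 0] exI[of _ t]) simp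
  qed
  show ?thesis unfolding ideal_def using assms mem by blast
qed

text \<open>Simplicity speaks of \<open>D\<close> on all tensors of degree two; a linear map that
  kills the pure ones vanishes there.\<close>

lemma simple_bracket_nonzero:
  assumes simple
  shows "\<exists>a b. bracket a b \<noteq> 0"
proof (rule ccontr)
  assume "\<not> ?thesis"
  then have 0: "bracket a b = 0" for a b by blast
  have "D t = 0" if "t \<in> tensor_power scale 2" for t
  proof (rule tensor_power_unique[OF bracket_linear _ tensor.vector_space_axioms _ that])
    show "linear_on (tensor_power scale 2) tensor_scale tensor_scale (\<lambda>_. 0 :: ('k, 'v) tensor)"
      by (simp add: linear_on_def)
    show "D (pure_tensor scale vs) = 0" if "length vs = 2" for vs
      using that 0 by (auto simp: bracket_def numeral_eq_Suc length_Suc_conv)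
  qed
  with assms show False by (auto simp: simple_def)
qed

text \<open>All right slices of all brackets lie in the span, which makes it an ideal. It can be
  zero only if every bracket is, by the basis expansion.\<close>

lemma simple_slices_span:
  assumes simple
  shows "span {slice_left \<phi> (bracket a w) | \<phi> a w. Vector_Spaces.linear scale (*) \<phi>} = UNIV"
    (is "span ?S = UNIV")
proof -
  have mem: "bracket v w \<in> subspace_tensor scale UNIV (span ?S)" for v w
    by (rule subspace_tensor_rightI[OF bracket_in_power], rule span_base) blast
  then have "ideal (span ?S)" by (intro idealI subspace_span) blast+
  moreover have "span ?S \<noteq> {0}"
  proof
    assume "span ?S = {0}"
    then have 0: "slice_left \<phi> (bracket a w) = 0" if "Vector_Spaces.linear scale (*) \<phi>" for \<phi> a w
      using that span_base[of "slice_left \<phi> (bracket a w)" ?S] by blast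
    have "bracket a w = 0" for a w
      using tensor_expand_left[OF bracket_in_power, of a w]
      by (simp add: 0[OF linear_representation] pure_tensor_2_zero)
    then show False using simple_bracket_nonzero[OF assms] by blast
  qed
  ultimately show ?thesis using assms unfolding simple_def by blast
qed

text \<open>If $U$ is invariant under all $G_{a,\phi}$, then the vectors sent into $U$ by all of them form an ideal:
  closure under the $F_{c,\psi}$ is the first associativity relation.\<close>

lemma simple_associative_irreducible:
  assumes simple: simple and assoc: associative
    and U: "subspace U" "U \<noteq> {0}"
    and inv: "\<And>\<phi> a w. Vector_Spaces.linear scale (*) \<phi> \<Longrightarrow> w \<in> U \<Longrightarrow> slice_left \<phi> (bracket a w) \<in> U"
  shows "U = UNIV"
proof -
  define W where
    "W = {v. \<forall>\<phi> a. Vector_Spaces.linear scale (*) \<phi> \<longrightarrow> slice_left \<phi> (bracket a v) \<in> U}"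
  have sub: "U \<subseteq> W" using inv by (auto simp: W_def)
  have "subspace W"
    using U(1) by (auto simp: W_def subspace_def bracket_bilinear bracket_zero slice_linear)
  moreover have "bracket v w \<in> subspace_tensor scale W UNIV" if "v \<in> W" for v w
  proof (rule subspace_tensor_leftI[OF bracket_in_power])
    fix \<psi> assume "Vector_Spaces.linear scale (*) \<psi>"
    \<comment> \<open>After the first relation the slice is taken of \<open>bracket a v\<close> by a
      composed functional; as \<open>v\<close> is in \<open>W\<close>, every linear functional sends
      it into \<open>U\<close>.\<close>
    then show "slice_right \<psi> (bracket v w) \<in> W"
      using that linear_slice_bracket by (simp add: W_def associative_slice13[OF assoc])
  qed
  \<comment> \<open>The slices lie in \<open>U\<close> by the definition of \<open>W\<close>, hence
    in \<open>W\<close> by the inclusion.\<close>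
  moreover have "bracket v w \<in> subspace_tensor scale UNIV W" if "w \<in> W" for v w
    by (rule subspace_tensor_rightI[OF bracket_in_power], rule subsetD[OF sub])
      (use that in \<open>simp add: W_def\<close>)
  ultimately have "ideal W" by (intro idealI) blast+
  moreover have "W \<noteq> {0}" using sub U subspace_0 by blast
  ultimately have "W = UNIV" using simple unfolding simple_def by blast
  \<comment> \<open>Now \<open>U\<close> contains every slice, and the slices span V.\<close>
  then have "{slice_left \<phi> (bracket a w) | \<phi> a w. Vector_Spaces.linear scale (*) \<phi>} \<subseteq> U"
    by (auto simp: W_def)
  then have "span {slice_left \<phi> (bracket a w) | \<phi> a w. Vector_Spaces.linear scale (*) \<phi>} \<subseteq> U"
    using U(1) by (rule span_minimal)
  then show ?thesis using simple_slices_span[OF simple] by blast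
qed

section \<open>Schur's lemma and the form of the bracket\<close>

text \<open>Schur's lemma: by the second relation, $a \mapsto G_{a,\phi}\, w$ commutes with every $G_{b,\psi}$,
  so its eigenspaces are invariant.\<close>

lemma slice_left_scalar:
  assumes simple: simple and assoc: associative and \<phi>: "Vector_Spaces.linear scale (*) \<phi>"
    and v: "v \<noteq> 0" "slice_left \<phi> (bracket v w) = scale c v"
  shows "slice_left \<phi> (bracket a w) = scale c a"
proof -
  define U where "U = {a. slice_left \<phi> (bracket a w) = scale c a}"
  have "U = UNIV"
  proof (rule simple_associative_irreducible[OF simple assoc])
    show "subspace U"
      by (auto simp: U_def subspace_def bracket_bilinear bracket_zero slice_linear
          scale_right_distrib mult.commute)
    show "U \<noteq> {0}" using v by (auto simp: U_def)
    \<comment> \<open>Read from right to left, the second relation moves the slice by \<phi> inside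
      \<open>bracket b _\<close>, where it acts on \<open>x\<close> as the scalar
      \<open>c\<close>.\<close>
    show "slice_left \<psi> (bracket b x) \<in> U" if "Vector_Spaces.linear scale (*) \<psi>" "x \<in> U" for \<psi> b x
      using that by (simp add: U_def associative_slice12[OF assoc that(1) \<phi>, symmetric]
          bracket_bilinear slice_linear)
  qed
  then show ?thesis by (auto simp: U_def)
qed

text \<open>Algebraic closedness enters through \<open>eigen\<close>: it supplies the one
  eigenvector from which Schur's lemma reaches all of V.\<close>

lemma slice_left_bracket_scalar:
  fixes \<phi> :: "'v \<Rightarrow> 'k"
  assumes eigen: "\<And>T. Vector_Spaces.linear scale scale T \<Longrightarrow> \<exists>c v. v \<noteq> 0 \<and> T v = scale c v"
    and simple: simple and assoc: associative and \<phi>: "Vector_Spaces.linear scale (*) \<phi>"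
  shows "\<exists>c. \<forall>a. slice_left \<phi> (bracket a w) = scale c a"
proof -
  have "Vector_Spaces.linear scale scale (\<lambda>a. slice_left \<phi> (bracket a w))"
    by unfold_locales (auto simp: bracket_bilinear slice_linear)
  from eigen[OF this] show ?thesis using slice_left_scalar[OF simple assoc \<phi>] by blast
qed

text \<open>Every coordinate slice of \<open>bracket a w\<close> is a multiple of \<open>a\<close>,
  so in the basis expansion \<open>a\<close> can be pulled out as the common right factor.\<close>

lemma simple_associative_bracket_form:
  assumes eigen: "\<And>T. Vector_Spaces.linear scale scale T \<Longrightarrow> \<exists>c v. v \<noteq> 0 \<and> T v = scale c v"
    and simple: simple and assoc: associative
  obtains M where "Vector_Spaces.linear scale scale M"
    and "\<And>a w. bracket a w = pure_tensor scale [M w, a]"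
proof -
  obtain m where m: "slice_left (\<lambda>v. representation Basis v j) (bracket a w) = scale (m j w) a" for j a w
    using slice_left_bracket_scalar[OF eigen simple assoc linear_representation] by metis
  define M where "M w = (\<Sum>j\<in>Basis. scale (m j w) j)" for w
  have M: "bracket a w = pure_tensor scale [M w, a]" for a w
    using tensor_expand_left[OF bracket_in_power, of a w]
    by (simp add: M_def m pure_tensor_2_linear pure_tensor_2_sum)
  obtain a b where "bracket a b \<noteq> 0" using simple_bracket_nonzero[OF simple] by blast
  then have "a \<noteq> 0" by (auto simp: bracket_zero)
  \<comment> \<open>The scalars \<open>m j w\<close> were merely chosen, so linearity of
    \<open>M\<close> is still open. Slicing with a functional that is nonzero at \<open>a\<close>
    recovers \<open>M w\<close> from the bracket, which is linear in \<open>w\<close>.\<close>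
  then obtain \<psi> where \<psi>: "Vector_Spaces.linear scale (*) \<psi>" "\<psi> a \<noteq> 0"
    using separating_functional[OF vector_space_axioms, of a 0] linear_functional(3) by metis
  have slice: "M w = scale (inverse (\<psi> a)) (slice_right \<psi> (bracket a w))" for w
    using \<psi>(2) by (simp add: M slice_right_pure[OF \<psi>(1)])
  have "Vector_Spaces.linear scale scale M"
    by unfold_locales
      (auto simp: slice bracket_bilinear slice_linear scale_right_distrib mult.commute)
  with M show thesis using that by blast
qed

lemma simple_associative_imp_one_dimensional:
  assumes eigen: "\<And>T. Vector_Spaces.linear scale scale T \<Longrightarrow> \<exists>c v. v \<noteq> 0 \<and> T v = scale c v"
    and simple: simple and assoc: associative
  shows "dim UNIV = 1 \<and>
    (\<exists>\<alpha>. \<alpha> \<noteq> 0 \<and> (\<forall>u v. bracket u v = tensor_scale \<alpha> (pure_tensor scale [u, v])))"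
proof -
  obtain M where M: "Vector_Spaces.linear scale scale M"
    and bracket: "bracket a w = pure_tensor scale [M w, a]" for a w
    using simple_associative_bracket_form[OF assms] by blast
  interpret M: Vector_Spaces.linear scale scale M by (rule M)
  obtain c v where v: "v \<noteq> 0" "M v = scale c v" using eigen[OF M] by blast
  have Mw: "M w \<in> span {v}" if "w \<in> span {v}" for w
    using that v by (auto simp: span_singleton M.scale mult.commute)
  \<comment> \<open>In the tensor of \<open>M y\<close> and \<open>x\<close>, an \<open>x\<close> on
    the line puts the right factor there; a \<open>y\<close> on the line puts the left factor there,
    as \<open>M\<close> preserves the line.\<close>
  have "ideal (span {v})"
  proof (rule idealI)
    show "subspace (span {v})" by (rule subspace_span)
    show "bracket x y \<in> subspace_tensor scale (span {v}) UNIV \<or>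
        bracket x y \<in> subspace_tensor scale UNIV (span {v})" if "x \<in> span {v}" for x y
      using that unfolding bracket subspace_tensor_def by (blast intro: tensor.span_base)
    show "bracket x y \<in> subspace_tensor scale (span {v}) UNIV \<or>
        bracket x y \<in> subspace_tensor scale UNIV (span {v})" if "y \<in> span {v}" for x y
      using Mw[OF that] unfolding bracket subspace_tensor_def by (blast intro: tensor.span_base)
  qed
  moreover have "span {v} \<noteq> {0}" using v span_base[of v "{v}"] by auto
  ultimately have univ: "span {v} = UNIV" using simple unfolding simple_def by blast
  have "independent {v}" using v by (simp add: dependent_single)
  then have "dim UNIV = 1" using dim_span_eq_card_independent[of "{v}"] univ by simp
  \<comment> \<open>All vectors are multiples of \<open>v\<close>, so \<open>M\<close> is
    multiplication by \<open>c\<close> and the two factors may be interchanged.\<close>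
  moreover have br: "bracket x y = tensor_scale c (pure_tensor scale [x, y])" for x y
  proof -
    have "x \<in> span {v}" "y \<in> span {v}" using univ by auto
    then obtain r s where "x = scale r v" "y = scale s v" by (auto simp: span_singleton)
    then show ?thesis
      by (simp only: bracket M.scale v pure_tensor_2_linear tensor.scale_scale mult_ac)
  qed
  moreover have "c \<noteq> 0"
    using simple_bracket_nonzero[OF simple] br by (metis tensor.scale_zero_left)
  ultimately show ?thesis by blast
qed

section \<open>The converse: scaled tensor products on a line\<close>

lemma pure_tensor_2_nonzero:
  assumes "x \<noteq> 0" "y \<noteq> 0"
  shows "pure_tensor scale [x, y] \<noteq> 0"
proof
  obtain \<phi> where \<phi>: "Vector_Spaces.linear scale (*) \<phi>" "\<phi> x \<noteq> 0"
    using separating_functional[OF vector_space_axioms, of x 0] assms linear_functional(3) by metis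
  assume "pure_tensor scale [x, y] = 0"
  then have "scale (\<phi> x) y = 0" using slice_left_pure[OF \<phi>(1), of x y] by (simp add: slice_linear)
  with \<phi> assms show False by simp
qed

text \<open>On a line there are no subspaces between zero and everything, and the bracket of a
  nonzero vector with itself is nonzero.\<close>

lemma simple_of_one_dimensional:
  assumes dim: "dim UNIV = 1" and \<alpha>: "\<alpha> \<noteq> 0"
    and br: "\<And>u v. bracket u v = tensor_scale \<alpha> (pure_tensor scale [u, v])"
  shows simple
proof -
  obtain v :: 'v where v: "v \<noteq> 0"
  proof -
    have "\<not> (UNIV :: 'v set) \<subseteq> {0}" using dim dim_eq_0[of UNIV] by simp
    then show thesis using that by blast
  qed
  have "D (pure_tensor scale [v, v]) \<noteq> 0"
    using pure_tensor_2_nonzero[OF v v] \<alpha> br[of v v] by (simp add: bracket_def)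
  then have "\<exists>t\<in>tensor_power scale 2. D t \<noteq> 0"
    using pure_tensor_in_power[of "[v, v]" 2 scale] by auto
  moreover have "I = {0} \<or> I = UNIV" if "subspace I" for I
  proof (cases "dim I = 0")
    case True
    then have "I \<subseteq> {0}" by (simp add: dim_eq_0)
    then show ?thesis using subspace_0[OF that] by auto
  next
    case False
    then have "dim UNIV \<le> dim I" using dim by linarith
    then have "I = UNIV" using that by (intro subspace_dim_equal) auto
    then show ?thesis ..
  qed
  ultimately show ?thesis unfolding simple_def ideal_def by blast
qed

text \<open>The permutations put the factors back in order, so all four expressions equal \<alpha>
  squared times the pure tensor of \<open>a\<close>, \<open>b\<close>, \<open>c\<close>.\<close>

lemma associative_of_scaled_identity:
  assumes br: "\<And>u v. bracket u v = tensor_scale \<alpha> (pure_tensor scale [u, v])"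
  shows associative
proof -
  note p1 = pure_tensor_in_power[OF refl, where scale = scale]
  have ext: "bracket_right_L (tensor_scale c t) = tensor_scale c (bracket_right_L t)"
    "bracket_right_R (tensor_scale c t) = tensor_scale c (bracket_right_R t)"
    "bracket_left_L (tensor_scale c t) = tensor_scale c (bracket_left_L t)"
    "bracket_left_R (tensor_scale c t) = tensor_scale c (bracket_left_R t)" for c t
    unfolding bracket_right_L_def bracket_right_R_def bracket_left_L_def bracket_left_R_def
    by (auto simp: tensor_lift_def tensor_scale_def fun_eq_iff)
  show ?thesis
    unfolding associative_def
    by (auto simp: br ext tensor_mult_scale_left tensor_mult_scale_right[OF vector_space_axioms p1 p1]
        tensor_mult_pure[OF vector_space_axioms] bracket_right_L_pure bracket_right_R_pure
        bracket_left_L_pure bracket_left_R_pure tensor_permute_linear tensor_permute_pure_3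
        simp del: One_nat_def)
qed

end

theorem corollary2:
  fixes scale :: "'k::alg_closed_field \<Rightarrow> 'v::ab_group_add \<Rightarrow> 'v"
    and B :: "'v set"
    and D :: "('k, 'v) tensor \<Rightarrow> ('k, 'v) tensor"
  assumes "finite_dimensional_vector_space scale B"
    and "double_algebra scale D"
  shows "double_algebra.simple scale D \<and> double_algebra.associative scale D \<longleftrightarrow>
    vector_space.dim scale UNIV = 1 \<and>
    (\<exists>\<alpha>. \<alpha> \<noteq> 0 \<and> (\<forall>u v. double_algebra.bracket scale D u v =
      tensor_scale \<alpha> (pure_tensor scale [u, v])))"
proof -
  interpret finite_dimensional_double_algebra scale B D
    using assms by (rule finite_dimensional_double_algebra.intro)
  show ?thesis
  proof
    assume *: "simple \<and> associative"
    \<comment> \<open>The search for eigenvectors starts from a nonzero vector; a nonzero bracket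
      guarantees that there is one.\<close>
    then obtain v :: 'v where "v \<noteq> 0" using simple_bracket_nonzero bracket_zero by metis
    then have "\<exists>c w. w \<noteq> 0 \<and> T w = scale c w" if "Vector_Spaces.linear scale scale T" for T
      using exists_eigenvector[OF assms(1) that] by blast
    then show "dim UNIV = 1 \<and>
        (\<exists>\<alpha>. \<alpha> \<noteq> 0 \<and> (\<forall>u v. bracket u v = tensor_scale \<alpha> (pure_tensor scale [u, v])))"
      using * by (intro simple_associative_imp_one_dimensional) auto
  qed (blast intro: simple_of_one_dimensional associative_of_scaled_identity)
qed

end
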